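(* Let $r>1$, and let $f_r(z)=\dfrac{\operatorname{Log}(1+rz)}{\operatorname{Log}(1+z)}$ for $z\in\mathbb{C}\setminus(-\infty,-1/r]$, with $f_r(0)=r$. Define $\omega_r:[1/r,\infty)\to[0,\infty)$ by $$\omega_r(t)=\begin{cases}\dfrac{-1}{\log(1-t)}, & 1/r\le t<1,\\[2mm] 0, & t=1,\\[1mm] \dfrac{\log\left((rt-1)/(t-1)\right)}{\log^2(t-1)+\pi^2}, & 1<t.\end{cases}$$ Then the following hold. (1) $f_r$ (restricted to $(0,\infty)$) is a Stieltjes function, and for all $z\in\mathbb{C}\setminus(-\infty,-1/r]$, $$f_r(z)=1+\int_{1/r}^\infty\frac{\omega_r(t)}{z+t}\,dt.$$ (2) On the interval $(-1/r,\infty)$ the function $f_r$ is strictly convex and strictly decreasing from $\infty$ to $1$ (that is, $\lim_{x\to(-1/r)^+}f_r(x)=\infty$ and $\lim_{x\to\infty}f_r(x)=1$). (3) $$\int_{1/r}^\infty\frac{\omega_r(t)}{t}\,dt=r-1.$$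
   Context: $\operatorname{Log}$ is the principal branch of the logarithm on $\mathbb{C}\setminus(-\infty,0]$, $\operatorname{Log}(z)=\log|z|+i\operatorname{Arg}(z)$ with $\operatorname{Arg}(z)\in(-\pi,\pi)$; $\log$ is the real natural logarithm and $\log^2(u)=(\log u)^2$. The point $z=0$ is a removable singularity of the quotient defining $f_r$, with value $f_r(0)=r$, so $f_r$ is holomorphic on $\mathbb{C}\setminus(-\infty,-1/r]$. A Stieltjes function is a function $f:(0,\infty)\to[0,\infty)$ of the form $$f(x)=c+\int_{[0,\infty)}\frac{d\mu(t)}{x+t},\quad x>0,$$ where $c\ge 0$ and $\mu$ is a positive measure on $[0,\infty)$ such that the integral converges for every $x>0$. *)

theory Defs
  imports "HOL-Analysis.Analysis"
begin

text \<open>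
  The constant \<open>Ln\<close> on \<^typ>\<open>complex\<close> is the principal branch of the logarithm. The
  quotient is only meant on the plane cut along \<open>(-\<infinity>, -1/r]\<close>. There (for \<open>r > 1\<close>) both
  arguments of \<open>Ln\<close> avoid \<open>(-\<infinity>, 0]\<close>, and the denominator vanishes only at \<open>0\<close>, where the
  singularity is removable.
\<close>

definition log_ratio :: "real \<Rightarrow> complex \<Rightarrow> complex"
  where "log_ratio r z =
    (if z = 0 then of_real r else Ln (1 + of_real r * z) / Ln (1 + z))"

text \<open>This density is only meant on \<open>[1/r, \<infinity>)\<close>; its values elsewhere are irrelevant.\<close>

definition log_ratio_density :: "real \<Rightarrow> real \<Rightarrow> real"
  where "log_ratio_density r t =
    (if t < 1 then - 1 / ln (1 - t)
     else if t = 1 then 0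
     else ln ((r * t - 1) / (t - 1)) / ((ln (t - 1))\<^sup>2 + pi\<^sup>2))"

lemma log_ratio_density_nonneg:
  assumes "r > 1" and "1 / r \<le> t"
  shows "log_ratio_density r t \<ge> 0"
proof -
  have "t > 0"
    using assms by (smt (verit) divide_pos_pos)
  consider "t < 1" | "t = 1" | "t > 1"
    by linarith
  then show ?thesis
  proof cases
    case 1
    then have "ln (1 - t) < 0"
      using \<open>t > 0\<close> by simp
    with 1 show ?thesis
      by (simp add: log_ratio_density_def divide_nonpos_neg)
  next
    case 2
    then show ?thesis
      by (simp add: log_ratio_density_def)
  next
    case 3
    then have "t < r * t"
      using assms by simp
    with 3 have "(r * t - 1) / (t - 1) \<ge> 1"
      by simp
    then have "ln ((r * t - 1) / (t - 1)) \<ge> 0"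
      by simp
    with 3 show ?thesis
      by (simp add: log_ratio_density_def)
  qed
qed

text \<open>
  A function on \<open>(0, \<infinity>)\<close> is represented by a total function whose values outside \<open>(0, \<infinity>)\<close>
  are ignored. The condition on \<^term>\<open>sets \<mu>\<close> makes \<open>\<mu>\<close> a Borel measure with underlying
  space \<open>[0, \<infinity>)\<close>. The representation forces the values on \<open>(0, \<infinity>)\<close> to be nonnegative.
\<close>

definition stieltjes_function :: "(real \<Rightarrow> real) \<Rightarrow> bool"
  where "stieltjes_function f \<longleftrightarrow>
    (\<exists>c \<mu>. c \<ge> 0 \<and> sets \<mu> = sets (restrict_space borel {0..}) \<and>
      (\<forall>x>0. integrable \<mu> (\<lambda>t. 1 / (x + t)) \<and>
             f x = c + (LINT t|\<mu>. 1 / (x + t))))"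

definition strictly_convex_on :: "'a::real_vector set \<Rightarrow> ('a \<Rightarrow> real) \<Rightarrow> bool"
  where "strictly_convex_on S f \<longleftrightarrow> convex S \<and>
    (\<forall>x\<in>S. \<forall>y\<in>S. x \<noteq> y \<longrightarrow> (\<forall>u>0. \<forall>v>0. u + v = 1 \<longrightarrow>
      f (u *\<^sub>R x + v *\<^sub>R y) < u * f x + v * f y))"

end

theory Submission
  imports Defs "HOL-Complex_Analysis.Complex_Analysis" "HOL-Real_Asymp.Real_Asymp"
begin

text \<open>
  Integrating \<open>e\<^sup>s / (s (w - e\<^sup>s))\<close> around the rectangle bounded by \<open>Im s = -\<pi>\<close>, \<open>Im s = \<pi>\<close>,
  where its only poles are \<open>0\<close> and \<open>Ln w\<close>, gives, after substituting \<open>t = 1 + e\<^sup>x\<close> and \<open>w = 1 + z\<close>,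
  \<open>1 / Ln (1 + z) = 1 / z + \<integral> dt / ((z + t) (ln\<^sup>2 (t - 1) + \<pi>\<^sup>2))\<close> over \<open>t > 1\<close>. The quotient itself is
  recovered from \<open>f\<^sub>r(z) - 1 = \<integral> z / (s (z + s) Ln (1 + z)) ds\<close> over \<open>1/r < s < 1\<close>: partial fractions
  express the integrand through the formula above at \<open>z\<close> and at \<open>-s\<close>, the latter producing the density
  on \<open>[1/r, 1)\<close>, and exchanging the order of integration produces the density on \<open>(1, \<infinity>)\<close>. Absolute
  convergence is the positive case \<open>z = 0\<close>. Monotonicity and strict convexity are inherited from
  \<open>x \<mapsto> 1 / (x + t)\<close>, since the density is positive on \<open>[1/r, 1)\<close>.
\<close>

subsection \<open>Contour integral of the exponential kernel\<close>

text \<open>Two logarithms of \<open>w\<close> differ by a multiple of 2 pi i, and the bound on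
  \<open>Im s\<close> leaves room only for the zero multiple. Because |Im (Ln w)| < pi, this strip
  is wider than |Im s| \<le> pi.\<close>

lemma exp_eq_in_strip:
  assumes w: "w \<notin> \<real>\<^sub>\<le>\<^sub>0" and "exp s = w" and "\<bar>Im s\<bar> < 2 * pi - \<bar>Im (Ln w)\<bar>"
  shows "s = Ln w"
proof -
  have w0: "w \<noteq> 0"
    using w by auto
  then have "exp s = exp (Ln w)"
    using assms by simp
  then obtain n :: int where n: "s = Ln w + (of_int (2 * n) * pi) * \<i>"
    by (auto simp: exp_eq)
  then have "Im s = Im (Ln w) + 2 * of_int n * pi"
    by simp
  then have "\<bar>2 * of_int n * pi\<bar> < 2 * pi"
    using assms(3) by linarith
  then have "\<bar>of_int n\<bar> < (1::real)"
    by (simp add: abs_mult)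
  then have "n = 0"
    by linarith
  with n show ?thesis
    by simp
qed

lemma abs_Im_Ln_less_pi:
  assumes w: "w \<notin> \<real>\<^sub>\<le>\<^sub>0"
  shows "\<bar>Im (Ln w)\<bar> < pi"
proof -
  have "w \<noteq> 0"
    using w by auto
  then show ?thesis
    using w Im_Ln_less_pi mpi_less_Im_Ln
    by (smt (verit, ccfv_threshold) Im_Ln_eq_pi_half Im_Ln_eq_pi Im_Ln_le_pi complex_nonpos_Reals_iff)
qed

text \<open>Residue theorem with two simple poles, distinct because \<open>w \<noteq> 1\<close>:
  residue 1 / (w - 1) at 0 and -1 / Ln w at \<open>Ln w\<close>. The bound on \<open>R\<close>
  places \<open>Ln w\<close> inside the rectangle.\<close>

lemma rectpath_integral_exp_kernel:
  assumes w: "w \<notin> \<real>\<^sub>\<le>\<^sub>0" and w1: "w \<noteq> 1" and R: "R > norm (Ln w)"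
  shows "contour_integral (rectpath (Complex (-R) (-pi)) (Complex R pi))
           (\<lambda>s. exp s / (s * (w - exp s))) = 2 * pi * \<i> * (1 / (w - 1) - 1 / Ln w)"
proof -
  let ?G = "\<lambda>s. exp s / (s * (w - exp s))"
  let ?\<gamma> = "rectpath (Complex (-R) (-pi)) (Complex R pi)"
  \<comment> \<open>This half-height exceeds pi, so the open strip \<open>S\<close> contains the
    closed rectangle, yet \<open>Ln w\<close> is still the only logarithm of \<open>w\<close> in
    it.\<close>
  define d where "d = 2 * pi - \<bar>Im (Ln w)\<bar>"
  have w0: "w \<noteq> 0"
    using w by auto
  have Lw0: "Ln w \<noteq> 0"
    using w0 w1 by (metis exp_Ln exp_zero)
  have ImL: "\<bar>Im (Ln w)\<bar> < pi"
    by (rule abs_Im_Ln_less_pi) (rule w)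
  have d: "d > pi"
    using ImL by (simp add: d_def)
  have R0: "R > 0"
    using R norm_ge_zero[of "Ln w"] by linarith
  define S where "S = {s. \<bar>Im s\<bar> < d}"
  have S_eq: "S = {s. Im s < d} \<inter> {s. Im s > -d}"
    by (auto simp: S_def)
  have "open S" "convex S"
    unfolding S_eq by (auto intro!: open_Int convex_Int open_halfspace_Im_lt open_halfspace_Im_gt
        convex_halfspace_Im_lt convex_halfspace_Im_gt)
  have strip: "s = Ln w" if "s \<in> S" "exp s = w" for s
    using exp_eq_in_strip[OF w that(2)] that(1) by (auto simp: S_def d_def)
  have box: "0 \<in> box (Complex (-R) (-pi)) (Complex R pi)" "Ln w \<in> box (Complex (-R) (-pi)) (Complex R pi)"
    using R R0 ImL abs_Re_le_cmod[of "Ln w"] by (auto simp: in_box_complex_iff)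
  have path: "path_image ?\<gamma> \<subseteq> S - {0, Ln w}"
  proof -
    have "path_image ?\<gamma> \<inter> box (Complex (-R) (-pi)) (Complex R pi) = {}"
      by (rule path_image_rectpath_inter_box) (use R0 in auto)
    moreover have "path_image ?\<gamma> \<subseteq> cbox (Complex (-R) (-pi)) (Complex R pi)"
      by (rule path_image_rectpath_subset_cbox) (use R0 in auto)
    moreover have "cbox (Complex (-R) (-pi)) (Complex R pi) \<subseteq> S"
      using d by (auto simp: in_cbox_complex_iff S_def)
    ultimately show ?thesis
      using box by blast
  qed
  have "contour_integral ?\<gamma> ?G = 2 * pi * \<i> * (\<Sum>p\<in>{0, Ln w}. winding_number ?\<gamma> p * residue ?G p)"
  proof (rule Residue_theorem)
    show "?G holomorphic_on S - {0, Ln w}"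
      using strip by (auto intro!: holomorphic_intros)
    show "\<forall>z. z \<notin> S \<longrightarrow> winding_number ?\<gamma> z = 0"
      using \<open>convex S\<close> path
      by (intro allI impI winding_number_zero_outside[of _ S]) auto
  qed (use \<open>open S\<close> \<open>convex S\<close> path in \<open>auto simp: convex_connected\<close>)
  also have "\<dots> = 2 * pi * \<i> * (residue ?G 0 + residue ?G (Ln w))"
    using box Lw0 by (auto simp: winding_number_rectpath)
  also have "residue ?G 0 = 1 / (w - 1)"
  proof -
    let ?U = "{s. w - exp s \<noteq> 0}"
    have "residue (\<lambda>s. (exp s / (w - exp s)) / (s - 0)) 0 = exp 0 / (w - exp 0)"
    proof (rule residue_simple)
      show "open ?U"
        by (intro open_Collect_neq continuous_intros)
      show "(\<lambda>s. exp s / (w - exp s)) holomorphic_on ?U"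
        by (intro holomorphic_intros) auto
    qed (use w1 in auto)
    then show ?thesis
      by (simp add: mult.commute)
  qed
  also have "residue ?G (Ln w) = - 1 / Ln w"
  proof -
    have "residue (\<lambda>s. (exp s / s) / (w - exp s)) (Ln w) = (exp (Ln w) / Ln w) / (- exp (Ln w))"
    proof (rule residue_simple_pole_deriv)
      show "(\<lambda>s. exp s / s) holomorphic_on ball (Ln w) (norm (Ln w))"
        by (auto intro!: holomorphic_intros)
      show "((\<lambda>s. w - exp s) has_field_derivative - exp (Ln w)) (at (Ln w))"
        by (auto intro!: derivative_eq_intros)
    qed (use Lw0 w0 in \<open>auto intro!: holomorphic_intros\<close>)
    then show ?thesis
      using w0 by (simp add: field_simps)
  qed
  finally show ?thesis
    by simp
qed

section \<open>Contour integrals over the sides of a rectangle\<close>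

lemma contour_integral_linepath_same_Im:
  fixes a b c :: real
  assumes "a < b"
  shows "contour_integral (linepath (Complex a c) (Complex b c)) f =
           integral {a..b} (\<lambda>x. f (Complex x c))"
proof -
  have *: "linepath (Complex a c) (Complex b c) x = linepath (of_real a) (of_real b) x + \<i> * c" for x
    by (simp add: linepath_def complex_eq_iff algebra_simps)
  have "contour_integral (linepath (Complex a c) (Complex b c)) f =
        contour_integral (linepath (of_real a) (of_real b)) (\<lambda>z. f (z + \<i> * c))"
    unfolding contour_integral_integral vector_derivative_linepath_at
    by (intro integral_cong) (auto simp: * complex_eq_iff)
  also have "\<dots> = integral {a..b} (\<lambda>x. f (Complex x c))"
    by (subst contour_integral_linepath_Reals_eq) (use assms in \<open>auto simp: Complex_eq\<close>)
  finally show ?thesis .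
qed

lemma contour_integral_rectpath_split:
  assumes "continuous_on (path_image (rectpath (Complex a c) (Complex b d))) f"
    and "a < b"
  shows "contour_integral (rectpath (Complex a c) (Complex b d)) f =
      integral {a..b} (\<lambda>x. f (Complex x c)) - integral {a..b} (\<lambda>x. f (Complex x d))
      + (contour_integral (linepath (Complex b c) (Complex b d)) f
         + contour_integral (linepath (Complex a d) (Complex a c)) f)"
proof -
  have cont: "f contour_integrable_on linepath (Complex a c) (Complex b c)"
       "f contour_integrable_on linepath (Complex b c) (Complex b d)"
       "f contour_integrable_on linepath (Complex b d) (Complex a d)"
       "f contour_integrable_on linepath (Complex a d) (Complex a c)"
    using assms(1)
    by (auto simp: rectpath_def Let_def path_image_join
        intro!: contour_integrable_continuous_linepath elim: continuous_on_subset)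
  have "contour_integral (linepath (Complex b d) (Complex a d)) f =
        - contour_integral (linepath (Complex a d) (Complex b d)) f"
    using cont(3) by (metis contour_integral_reversepath reversepath_linepath valid_path_linepath)
  with cont show ?thesis
    by (simp add: rectpath_def Let_def contour_integral_linepath_same_Im[OF assms(2)])
qed

section \<open>Distance to the cut and integrability of the kernel\<close>

lemma not_in_cut_add_nonzero:
  assumes "z \<notin> complex_of_real ` {..-a}" "a \<le> t"
  shows "z + of_real t \<noteq> 0"
proof
  assume "z + of_real t = 0"
  then have "z = of_real (-t)"
    by (metis add_eq_0_iff2 of_real_minus)
  moreover have "- t \<in> {..-a}"
    using assms by simp
  ultimately show False
    using assms by blast
qed

lemma not_in_cut_mono:
  assumes "z \<notin> complex_of_real ` {..-a}" "a \<le> b"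
  shows "z \<notin> complex_of_real ` {..-b}"
  using assms by auto

text \<open>For t > 2 |z| the triangle inequality bounds |t| / |z + t| by 2; on the remaining
  compact interval this quotient is continuous, since z + t does not vanish off the cut, and attains
  a maximum. The estimate is the source of every domination below, with a = 0 for the kernel in
  \<open>w\<close> and a = 1/r for the final formula.\<close>

lemma norm_le_dist_cut:
  fixes z :: complex
  assumes "z \<notin> complex_of_real ` {..-a}"
  obtains C where "C > 0" "\<And>t. t \<ge> a \<Longrightarrow> \<bar>t\<bar> \<le> C * norm (z + of_real t)"
proof -
  define K where "K = {a..max a (2 * norm z)}"
  note nz = not_in_cut_add_nonzero[OF assms]
  have K: "compact K" "K \<noteq> {}"
    by (simp_all add: K_def)
  have cont: "continuous_on K (\<lambda>t. \<bar>t\<bar> / norm (z + of_real t))"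
    by (intro continuous_intros) (auto simp: K_def nz)
  obtain t0 where t0: "\<forall>t\<in>K. \<bar>t\<bar> / norm (z + of_real t) \<le> \<bar>t0\<bar> / norm (z + of_real t0)"
    using continuous_attains_sup[OF K cont] by blast
  define C where "C = 2 + \<bar>t0\<bar> / norm (z + of_real t0)"
  have C: "C \<ge> 2" "\<bar>t0\<bar> / norm (z + of_real t0) \<le> C"
    by (auto simp: C_def)
  have "\<bar>t\<bar> \<le> C * norm (z + of_real t)" if t: "t \<ge> a" for t
  proof (cases "t \<in> K")
    case True
    then have "\<bar>t\<bar> / norm (z + of_real t) \<le> C"
      using t0[rule_format, OF True] C(2) by linarith
    moreover have "norm (z + of_real t) > 0"
      using nz[OF t] by simp
    ultimately show ?thesis
      using pos_divide_le_eq by blast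
  next
    case False
    then have "t > 2 * norm z"
      using t by (auto simp: K_def)
    moreover have "norm (of_real t :: complex) - norm z \<le> norm (z + of_real t)"
      using norm_diff_ineq[of "of_real t" z] by (simp add: add.commute)
    ultimately have "\<bar>t\<bar> \<le> 2 * norm (z + of_real t)"
      unfolding norm_of_real using norm_ge_zero[of z] by linarith
    also have "\<dots> \<le> C * norm (z + of_real t)"
      using C by (intro mult_right_mono) auto
    finally show ?thesis .
  qed
  moreover have "C > 0"
    using C by simp
  ultimately show thesis
    by (rule that[rotated])
qed

text \<open>The primitive arctan (x / pi) / pi has finite limits at both infinities and the
  integrand is nonnegative.\<close>

lemma integrable_inverse_square_plus_pi:
  "integrable lborel (\<lambda>x::real. 1 / (x\<^sup>2 + pi\<^sup>2))"
proof -
  have nz: "x\<^sup>2 + pi\<^sup>2 \<noteq> 0" for x :: real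
    by (simp add: add_nonneg_eq_0_iff)
  have "set_integrable lborel (einterval (-\<infinity>) \<infinity>) (\<lambda>x::real. 1 / (x\<^sup>2 + pi\<^sup>2))"
  proof (rule interval_integral_FTC_nonneg(1))
    show "((\<lambda>x. arctan (x / pi) / pi) has_real_derivative 1 / (x\<^sup>2 + pi\<^sup>2)) (at x)" for x
      using nz[of x] by (auto intro!: derivative_eq_intros simp: divide_simps power2_eq_square)
    show "isCont (\<lambda>x::real. 1 / (x\<^sup>2 + pi\<^sup>2)) x" for x
      by (intro continuous_intros nz)
    show "(((\<lambda>x. arctan (x / pi) / pi) \<circ> real_of_ereal) \<longlongrightarrow> - (pi / 2) / pi) (at_right (- \<infinity>))"
      unfolding ereal_tendsto_simps
      by (intro tendsto_intros filterlim_compose[OF tendsto_arctan_at_bot]) (real_asymp, simp)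
    show "(((\<lambda>x. arctan (x / pi) / pi) \<circ> real_of_ereal) \<longlongrightarrow> (pi / 2) / pi) (at_left \<infinity>)"
      unfolding ereal_tendsto_simps
      by (intro tendsto_intros filterlim_compose[OF tendsto_arctan_at_top]) (real_asymp, simp)
  qed (auto intro!: AE_I2)
  then show ?thesis
    by (simp add: set_integrable_def einterval_def)
qed

lemma integrable_Ln_kernel:
  fixes w :: complex
  assumes w: "w \<notin> \<real>\<^sub>\<le>\<^sub>0"
  shows "integrable lborel (\<lambda>x. of_real (exp x) / ((w + of_real (exp x)) * of_real (x\<^sup>2 + pi\<^sup>2)))"
proof -
  have "w \<notin> complex_of_real ` {..-0}"
    using w by (auto simp: nonpos_Reals_def)
  then obtain C where C: "C > 0" "\<And>t. t \<ge> 0 \<Longrightarrow> \<bar>t\<bar> \<le> C * norm (w + of_real t)"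
    using norm_le_dist_cut by metis
  show ?thesis
  proof (rule Bochner_Integration.integrable_bound)
    show "integrable lborel (\<lambda>x. C * (1 / (x\<^sup>2 + pi\<^sup>2)))"
      by (intro integrable_mult_right integrable_inverse_square_plus_pi)
    show "AE x in lborel. norm (of_real (exp x) / ((w + of_real (exp x)) * of_real (x\<^sup>2 + pi\<^sup>2)))
             \<le> norm (C * (1 / (x\<^sup>2 + pi\<^sup>2)))"
    proof (intro AE_I2)
      fix x :: real
      have le: "exp x \<le> C * norm (w + of_real (exp x))"
        using C(2)[of "exp x"] by simp
      then have pos: "norm (w + of_real (exp x)) > 0"
        by (smt (verit) exp_gt_zero mult_nonneg_nonpos C(1))
      have "x\<^sup>2 + pi\<^sup>2 > 0"
        by (simp add: add_nonneg_pos)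
      then have "norm (of_real (exp x) / ((w + of_real (exp x)) * of_real (x\<^sup>2 + pi\<^sup>2)))
           = exp x / norm (w + of_real (exp x)) * (1 / (x\<^sup>2 + pi\<^sup>2))"
        by (simp add: norm_divide norm_mult del: of_real_add of_real_power)
      also have "\<dots> \<le> C * (1 / (x\<^sup>2 + pi\<^sup>2))"
        using le pos by (intro mult_right_mono) (auto simp: divide_le_eq)
      finally show "norm (of_real (exp x) / ((w + of_real (exp x)) * of_real (x\<^sup>2 + pi\<^sup>2)))
             \<le> norm (C * (1 / (x\<^sup>2 + pi\<^sup>2)))"
        by (smt (verit) norm_ge_zero real_norm_def)
    qed
  qed measurable
qed

text \<open>On both horizontal sides exp s = - exp x, so only the factor 1/s differs: 1 / (x + i pi)
  - 1 / (x - i pi) = -2 pi i / (x^2 + pi^2). This produces the weight in the density.\<close>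

lemma exp_kernel_top_bottom:
  fixes w :: complex
  shows "exp (Complex x (-pi)) / (Complex x (-pi) * (w - exp (Complex x (-pi))))
       - exp (Complex x pi) / (Complex x pi * (w - exp (Complex x pi)))
       = - 2 * pi * \<i> * (of_real (exp x) / ((w + of_real (exp x)) * of_real (x\<^sup>2 + pi\<^sup>2)))"
proof -
  have e: "exp (Complex x (-pi)) = - of_real (exp x)" "exp (Complex x pi) = - of_real (exp x)"
    by (simp_all add: complex_eq_iff Re_exp Im_exp)
  have nz: "Complex x pi \<noteq> 0" "Complex x (-pi) \<noteq> 0"
    by (simp_all add: complex_eq_iff)
  have m: "of_real (x\<^sup>2 + pi\<^sup>2) = Complex x pi * Complex x (-pi)"
    by (simp add: complex_eq_iff power2_eq_square)
  have d: "Complex x pi - Complex x (-pi) = 2 * pi * \<i>"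
    by (simp add: complex_eq_iff)
  \<comment> \<open>If w + u = 0, both sides are 0 by the convention for division by zero; so
    \<open>w\<close> may be arbitrary here.\<close>
  have "- u / (a * (w + u)) + u / (b * (w + u)) = - (b - a) * (u / ((w + u) * (b * a)))"
    if "a \<noteq> 0" "b \<noteq> 0" for a b u :: complex
    using that by (cases "w + u = 0") (simp, simp add: divide_simps, simp add: algebra_simps)
  from this[OF nz(2) nz(1), of "of_real (exp x)"] show ?thesis
    unfolding e m by (simp add: d)
qed

text \<open>On the right side \<open>exp s\<close> dominates \<open>w\<close>, on the left side
  \<open>w\<close> dominates \<open>exp s\<close>; either way |exp s| \<le> 2 |w - exp s|. The decay
  then comes from 1 / |s| \<le> 1 / R.\<close>

lemma norm_exp_kernel_le:
  fixes w s :: complex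
  assumes w0: "w \<noteq> 0" and R0: "R > 0" and R: "exp R \<ge> 2 * norm w" "exp (-R) \<le> norm w / 2"
    and s: "\<bar>Re s\<bar> = R"
  shows "norm (exp s / (s * (w - exp s))) \<le> 2 / R"
proof -
  have le: "norm (exp s) \<le> 2 * norm (w - exp s)"
  proof (cases "Re s = R")
    case True
    then have "norm (exp s) \<ge> 2 * norm w"
      using R by simp
    then show ?thesis
      using norm_triangle_ineq3[of w "exp s"] norm_minus_commute[of w "exp s"] by linarith
  next
    case False
    then have "norm (exp s) \<le> norm w / 2"
    proof -
      have "Re s = - R"
        using s False by linarith
      then show ?thesis
        using R(2) by simp
    qed
    then show ?thesis
      using norm_triangle_ineq2[of w "exp s"] norm_ge_zero[of "exp s"] by linarith
  qed
  then have pos: "norm (w - exp s) > 0"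
    using exp_gt_zero[of "Re s"] unfolding norm_exp_eq_Re by linarith
  have "norm (exp s / (s * (w - exp s))) = (norm (exp s) / norm (w - exp s)) * (1 / norm s)"
    by (simp add: norm_divide norm_mult del: norm_exp_eq_Re)
  also have "\<dots> \<le> 2 * (1 / R)"
  proof (intro mult_mono)
    show "norm (exp s) / norm (w - exp s) \<le> 2"
      using le pos pos_divide_le_eq by blast
    show "1 / norm s \<le> 1 / R"
      using R0 s abs_Re_le_cmod[of s] by (intro frac_le) auto
  qed auto
  finally show ?thesis
    by simp
qed

text \<open>Dominated convergence with majorant \<open>norm (h x)\<close>: at each point the
  truncation is eventually exact. It turns the truncated integrals along the rectangle into one over
  the line.\<close>

lemma tendsto_integral_symmetric_interval:
  fixes h :: "real \<Rightarrow> 'a::euclidean_space"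
  assumes h: "integrable lborel h"
  shows "(\<lambda>n. integral {- real n..real n} h) \<longlonglongrightarrow> integral\<^sup>L lborel h"
proof -
  have [measurable]: "h \<in> borel_measurable lborel"
    using h by auto
  have "(\<lambda>n. LINT x|lborel. indicator {- real n..real n} x *\<^sub>R h x) \<longlonglongrightarrow> integral\<^sup>L lborel h"
  proof (rule integral_dominated_convergence)
    show "integrable lborel (\<lambda>x. norm (h x))"
      using h by simp
    show "AE x in lborel. (\<lambda>n. indicator {- real n..real n} x *\<^sub>R h x) \<longlonglongrightarrow> h x"
    proof (intro AE_I2)
      fix x :: real
      have "eventually (\<lambda>n. real n \<ge> \<bar>x\<bar>) sequentially"
        using eventually_ge_at_top[of "nat \<lceil>\<bar>x\<bar>\<rceil>"] by eventually_elim linarith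
      then have "eventually (\<lambda>n. indicator {- real n..real n} x *\<^sub>R h x = h x) sequentially"
        by eventually_elim (auto simp: indicator_def)
      then show "(\<lambda>n. indicator {- real n..real n} x *\<^sub>R h x) \<longlonglongrightarrow> h x"
        by (rule tendsto_eventually)
    qed
    show "AE x in lborel. norm (indicator {- real n..real n} x *\<^sub>R h x) \<le> norm (h x)" for n
      by (auto split: split_indicator)
  qed measurable
  moreover have "integral {- real n..real n} h = (LINT x|lborel. indicator {- real n..real n} x *\<^sub>R h x)" for n
    using set_borel_integral_eq_integral(2)[of "{- real n..real n}" h] h
    by (simp add: set_integrable_def set_lebesgue_integral_def integrable_mult_indicator)
  ultimately show ?thesis
    by simp
qed

text \<open>The zeros 0 and \<open>Ln w\<close> of the denominator lie strictly inside the
  rectangle, hence not on its boundary.\<close>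

lemma rectpath_exp_kernel_nonzero:
  assumes w: "w \<notin> \<real>\<^sub>\<le>\<^sub>0" and R: "R > norm (Ln w)" "R > 0"
    and s: "s \<in> path_image (rectpath (Complex (-R) (-pi)) (Complex R pi))"
  shows "s * (w - exp s) \<noteq> 0"
proof -
  have ImL: "\<bar>Im (Ln w)\<bar> < pi"
    by (rule abs_Im_Ln_less_pi) (rule w)
  have s': "(\<bar>Re s\<bar> = R) \<or> (\<bar>Im s\<bar> = pi)" "\<bar>Im s\<bar> \<le> pi"
    using s R(2) by (auto simp: path_image_rectpath)
  have "exp s \<noteq> w"
  proof
    assume "exp s = w"
    moreover have "\<bar>Im s\<bar> < 2 * pi - \<bar>Im (Ln w)\<bar>"
      using s'(2) ImL by linarith
    ultimately have "s = Ln w"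
      by (rule exp_eq_in_strip[OF w])
    then have "\<bar>Re s\<bar> < R" "\<bar>Im s\<bar> < pi"
      using R(1) ImL abs_Re_le_cmod[of "Ln w"] by (simp_all only:)
    with s'(1) show False
      by linarith
  qed
  moreover have "s \<noteq> 0"
    using s'(1) R(2) by auto
  ultimately show ?thesis
    by simp
qed

text \<open>The contour integral is evaluated twice, by residues and side by side. The discrepancy
  is the contribution of the two vertical sides, each of length 2 pi with integrand at most 2 /
  R.\<close>

lemma norm_truncated_Ln_kernel_le:
  fixes w :: complex
  assumes w: "w \<notin> \<real>\<^sub>\<le>\<^sub>0" and w1: "w \<noteq> 1"
    and R: "R > 0" "exp R \<ge> 2 * norm w" "exp (-R) \<le> norm w / 2" "R > norm (Ln w)"
  shows "norm (2 * pi * \<i> * (1 / (w - 1) - 1 / Ln w)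
      + 2 * pi * \<i> * integral {-R..R} (\<lambda>x. of_real (exp x) / ((w + of_real (exp x)) * of_real (x\<^sup>2 + pi\<^sup>2))))
      \<le> 8 * pi / R"
proof -
  define c where "c = 2 * pi * \<i> * (1 / (w - 1) - 1 / Ln w)"
  define h where "h x = of_real (exp x) / ((w + of_real (exp x)) * of_real (x\<^sup>2 + pi\<^sup>2))" for x
  let ?G = "\<lambda>s. exp s / (s * (w - exp s))"
  let ?v1 = "linepath (Complex R (-pi)) (Complex R pi)"
  let ?v2 = "linepath (Complex (-R) pi) (Complex (-R) (-pi))"
  let ?P = "path_image (rectpath (Complex (-R) (-pi)) (Complex R pi))"
  have w0: "w \<noteq> 0"
    using w by auto
  have cont: "continuous_on ?P ?G"
  proof (intro continuous_on_divide)
    show "continuous_on ?P (\<lambda>s. s * (w - exp s))"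
      by (intro continuous_intros)
    show "\<forall>s\<in>?P. s * (w - exp s) \<noteq> 0"
      using rectpath_exp_kernel_nonzero[OF w R(4,1)] by blast
  qed (intro continuous_intros)
  have e1: "contour_integral (rectpath (Complex (-R) (-pi)) (Complex R pi)) ?G = c"
    unfolding c_def by (rule rectpath_integral_exp_kernel[OF w w1 R(4)])
  have e2: "contour_integral (rectpath (Complex (-R) (-pi)) (Complex R pi)) ?G =
      integral {-R..R} (\<lambda>x. ?G (Complex x (-pi))) - integral {-R..R} (\<lambda>x. ?G (Complex x pi))
      + (contour_integral ?v1 ?G + contour_integral ?v2 ?G)"
    by (rule contour_integral_rectpath_split[OF cont]) (use R(1) in simp)
  have e3: "integral {-R..R} (\<lambda>x. ?G (Complex x (-pi))) - integral {-R..R} (\<lambda>x. ?G (Complex x pi))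
      = - (2 * pi * \<i> * integral {-R..R} h)"
  proof -
    have int: "(\<lambda>x. ?G (Complex x c)) integrable_on {-R..R}" if "\<bar>c\<bar> = pi" for c
    proof (rule integrable_continuous_interval)
      have sub: "(\<lambda>x. Complex x c) ` {-R..R} \<subseteq> ?P"
        using that R(1) by (auto simp: path_image_rectpath abs_if split: if_splits)
      have cont_line: "continuous_on {-R..R} (\<lambda>x. Complex x c)"
        unfolding Complex_eq by (intro continuous_intros)
      show "continuous_on {-R..R} (\<lambda>x. ?G (Complex x c))"
        by (rule continuous_on_compose2[OF cont cont_line sub])
    qed
    have "integral {-R..R} (\<lambda>x. ?G (Complex x (-pi))) - integral {-R..R} (\<lambda>x. ?G (Complex x pi))
      = integral {-R..R} (\<lambda>x. ?G (Complex x (-pi)) - ?G (Complex x pi))"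
      by (rule Henstock_Kurzweil_Integration.integral_diff [symmetric]; rule int; simp)
    also have "\<dots> = integral {-R..R} (\<lambda>x. - 2 * pi * \<i> * h x)"
      unfolding exp_kernel_top_bottom h_def ..
    also have "\<dots> = - (2 * pi * \<i> * integral {-R..R} h)"
      unfolding integral_mult_right by simp
    finally show ?thesis .
  qed
  have cancel: "x = - y + v \<Longrightarrow> x + y = v" for x y v :: complex
    by simp
  have "c = - (2 * pi * \<i> * integral {-R..R} h) + (contour_integral ?v1 ?G + contour_integral ?v2 ?G)"
    using e2 unfolding e1 e3 .
  then have eq: "c + 2 * pi * \<i> * integral {-R..R} h = contour_integral ?v1 ?G + contour_integral ?v2 ?G"
    by (rule cancel)
  have "norm (c + 2 * pi * \<i> * integral {-R..R} h)
      \<le> norm (contour_integral ?v1 ?G) + norm (contour_integral ?v2 ?G)"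
    unfolding eq by (rule norm_triangle_ineq)
  also have "\<dots> \<le> 2 / R * (2 * pi) + 2 / R * (2 * pi)"
  proof -
    have sub: "closed_segment (Complex a (-pi)) (Complex a pi) \<subseteq> ?P" if "\<bar>a\<bar> = R" for a
      using that R(1) by (auto simp: path_image_rectpath closed_segment_same_Re
          closed_segment_eq_real_ivl abs_if split: if_splits)
    have B: "norm (?G s) \<le> 2 / R"
      if "s \<in> closed_segment (Complex a (-pi)) (Complex a pi)" "\<bar>a\<bar> = R" for s a
      by (rule norm_exp_kernel_le[OF w0 R(1-3)]) (use that in \<open>simp add: closed_segment_same_Re\<close>)
    have int: "?G contour_integrable_on linepath a b" if "closed_segment a b \<subseteq> ?P" for a b
      by (rule contour_integrable_continuous_linepath) (rule continuous_on_subset[OF cont that])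
    have b1: "norm (contour_integral ?v1 ?G) \<le> 2 / R * norm (Complex R pi - Complex R (-pi))"
    proof (rule contour_integral_bound_linepath)
      show "?G contour_integrable_on ?v1"
        by (rule int, rule sub) (use R(1) in simp)
    qed (use R(1) B[of _ R] in auto)
    have b2: "norm (contour_integral ?v2 ?G) \<le> 2 / R * norm (Complex (-R) (-pi) - Complex (-R) pi)"
    proof (rule contour_integral_bound_linepath)
      show "?G contour_integrable_on ?v2"
        by (rule int, subst closed_segment_commute, rule sub) (use R(1) in simp)
    qed (use R(1) B[of _ "-R"] in \<open>auto simp: closed_segment_commute\<close>)
    have n: "norm (Complex R pi - Complex R (-pi)) = 2 * pi"
      "norm (Complex (-R) (-pi) - Complex (-R) pi) = 2 * pi"
      by (simp_all add: cmod_def real_sqrt_mult)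
    show ?thesis
      by (rule add_mono[OF b1[unfolded n] b2[unfolded n]])
  qed
  finally show ?thesis
    unfolding c_def h_def by simp
qed

text \<open>Letting R run through the integers to infinity in
  \<open>norm_truncated_Ln_kernel_le\<close> makes the error 8 pi / R vanish, and the limiting
  identity is solved for the integral.\<close>

lemma integral_Ln_kernel:
  fixes w :: complex
  assumes w: "w \<notin> \<real>\<^sub>\<le>\<^sub>0" and w1: "w \<noteq> 1"
  shows "(LINT x|lborel. of_real (exp x) / ((w + of_real (exp x)) * of_real (x\<^sup>2 + pi\<^sup>2)))
           = 1 / Ln w - 1 / (w - 1)"
proof -
  define h where "h = (\<lambda>x. of_real (exp x) / ((w + of_real (exp x)) * of_real (x\<^sup>2 + pi\<^sup>2)))"
  define c where "c = 2 * pi * \<i> * (1 / (w - 1) - 1 / Ln w)"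
  define I where "I n = integral {- real n..real n} h" for n :: nat
  have w0: "w \<noteq> 0"
    using w by auto
  have ev1: "eventually (\<lambda>n. exp (real n) \<ge> 2 * norm w) sequentially"
    by real_asymp
  have ev2: "eventually (\<lambda>n. exp (- real n) \<le> norm w / 2) sequentially"
  proof -
    have "((\<lambda>n. exp (- real n)) \<longlongrightarrow> 0) sequentially"
      by real_asymp
    then have "eventually (\<lambda>n. exp (- real n) < norm w / 2) sequentially"
      using w0 by (intro order_tendstoD) auto
    then show ?thesis
      by eventually_elim simp
  qed
  have ev3: "eventually (\<lambda>n. real n > norm (Ln w)) sequentially"
    by real_asymp
  have bound: "eventually (\<lambda>n. norm (c + 2 * pi * \<i> * I n) \<le> 8 * pi / real n) sequentially"
    using ev1 ev2 ev3 eventually_gt_at_top[of 0]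
  proof eventually_elim
    case (elim n)
    then show ?case
      unfolding c_def I_def h_def by (intro norm_truncated_Ln_kernel_le w w1) auto
  qed
  have "(\<lambda>n. 8 * pi / real n) \<longlonglongrightarrow> 0"
    by real_asymp
  then have "(\<lambda>n. c + 2 * pi * \<i> * I n) \<longlonglongrightarrow> 0"
    by (rule Lim_null_comparison[OF bound])
  moreover have "I \<longlonglongrightarrow> integral\<^sup>L lborel h"
    unfolding I_def h_def
    by (rule tendsto_integral_symmetric_interval[OF integrable_Ln_kernel[OF w]])
  then have "(\<lambda>n. c + 2 * pi * \<i> * I n) \<longlonglongrightarrow> c + 2 * pi * \<i> * integral\<^sup>L lborel h"
    by (intro tendsto_intros)
  ultimately have "c + 2 * pi * \<i> * integral\<^sup>L lborel h = 0"
    by (rule LIMSEQ_unique[symmetric])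
  then have "2 * pi * \<i> * (1 / (w - 1) - 1 / Ln w + integral\<^sup>L lborel h) = 0"
    by (simp add: c_def algebra_simps)
  then have "1 / (w - 1) - 1 / Ln w + integral\<^sup>L lborel h = 0"
    by simp
  then have "integral\<^sup>L lborel h = 1 / Ln w - 1 / (w - 1)"
    by (simp add: algebra_simps add_eq_0_iff)
  then show ?thesis
    by (simp add: h_def)
qed

subsection \<open>Integral representation of the reciprocal logarithm\<close>

text \<open>For t > 1 this is |ln (t - 1) + i pi|^2, the squared modulus of the boundary values of
  Ln (1 + z) at z = -t on the cut.\<close>

definition cut_weight :: "real \<Rightarrow> real"
  where "cut_weight t = (ln (t - 1))\<^sup>2 + pi\<^sup>2"

lemma cut_weight_pos: "cut_weight t > 0"
  by (simp add: cut_weight_def add_nonneg_pos)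

lemma borel_measurable_cut_weight [measurable]: "cut_weight \<in> borel_measurable borel"
  unfolding cut_weight_def by measurable

text \<open>The substitution t = 1 + e^x carries the line onto (1, \<infinity>) and
  \<open>integral_Ln_kernel\<close> with w = 1 + z onto this formula. Integrability includes z = 0,
  where the right-hand side would be singular.\<close>

lemma inverse_Ln_integral:
  fixes z :: complex
  assumes z: "z \<notin> complex_of_real ` {..-1}"
  defines "f \<equiv> \<lambda>t. 1 / ((z + of_real t) * of_real (cut_weight t))"
  shows inverse_Ln_integrable: "set_integrable lborel {1<..} f"
    and "z \<noteq> 0 \<Longrightarrow> (LINT t:{1<..}|lborel. f t) = 1 / Ln (1 + z) - 1 / z"
proof -
  define h where "h x = of_real (exp x) / ((1 + z + of_real (exp x)) * of_real (x\<^sup>2 + pi\<^sup>2))" for x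
  have w: "1 + z \<notin> \<real>\<^sub>\<le>\<^sub>0"
  proof
    assume "1 + z \<in> \<real>\<^sub>\<le>\<^sub>0"
    then have "Re z \<in> {..-1}" "z = of_real (Re z)"
      by (auto simp: complex_nonpos_Reals_iff complex_eq_iff)
    with z show False
      by blast
  qed
  have h: "integrable lborel h"
    unfolding h_def by (rule integrable_Ln_kernel[OF w])
  have h': "h absolutely_integrable_on UNIV"
    using h borel_measurable_integrable[OF h] by (simp add: set_integrable_def integrable_completion)
  have h'': "integral UNIV h = integral\<^sup>L lborel h"
    by (rule integral_unique[OF has_integral_integral_lborel[OF h]])
  have image: "(\<lambda>x::real. 1 + exp x) ` UNIV = {1<..}"
  proof
    show "{1<..} \<subseteq> (\<lambda>x::real. 1 + exp x) ` UNIV"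
    proof
      fix y :: real
      assume "y \<in> {1<..}"
      then have "y = 1 + exp (ln (y - 1))"
        by simp
      then show "y \<in> (\<lambda>x::real. 1 + exp x) ` UNIV"
        by blast
    qed
  qed auto
  have subst: "\<bar>exp x\<bar> *\<^sub>R f (1 + exp x) = h x" for x
    by (simp add: f_def h_def cut_weight_def scaleR_conv_of_real add_ac)
  have "(\<lambda>x. \<bar>exp x\<bar> *\<^sub>R f (1 + exp x)) absolutely_integrable_on UNIV \<and>
          integral UNIV (\<lambda>x. \<bar>exp x\<bar> *\<^sub>R f (1 + exp x)) = integral\<^sup>L lborel h
        \<longleftrightarrow> f absolutely_integrable_on (\<lambda>x. 1 + exp x) ` UNIV \<and>
          integral ((\<lambda>x. 1 + exp x) ` UNIV) f = integral\<^sup>L lborel h"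
    by (rule has_absolute_integral_change_of_variables_real)
       (auto intro!: derivative_eq_intros injI)
  then have f: "f absolutely_integrable_on {1<..}" "integral {1<..} f = integral\<^sup>L lborel h"
    unfolding image subst using h' h'' by (simp_all only: simp_thms)
  \<comment> \<open>The change of variables speaks about the completed Lebesgue measure; Borel
    measurability brings integrability back to \<open>lborel\<close>.\<close>
  have "(\<lambda>t. indicator {1<..} t *\<^sub>R f t) \<in> borel_measurable lborel"
    unfolding f_def cut_weight_def by measurable
  then show int: "set_integrable lborel {1<..} f"
    using f(1) by (simp add: set_integrable_def integrable_completion)
  assume "z \<noteq> 0"
  then have "integral\<^sup>L lborel h = 1 / Ln (1 + z) - 1 / z"
    using integral_Ln_kernel[OF w] by (simp add: h_def [abs_def])
  then show "(LINT t:{1<..}|lborel. f t) = 1 / Ln (1 + z) - 1 / z"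
    using set_borel_integral_eq_integral(2)[OF int] f(2) by simp
qed

text \<open>This is \<open>inverse_Ln_integral\<close> at z = -s, which lies off the cut because s <
  1. There the integrand and Ln (1 - s) are real.\<close>

lemma inverse_ln_integral:
  fixes s :: real
  assumes s: "0 < s" "s < 1"
  shows inverse_ln_integrable_complex:
      "set_integrable lborel {1<..} (\<lambda>t. complex_of_real (1 / ((t - s) * cut_weight t)))"
    and inverse_ln_integrable:
      "set_integrable lborel {1<..} (\<lambda>t. 1 / ((t - s) * cut_weight t))"
    and "(LINT t:{1<..}|lborel. 1 / ((t - s) * cut_weight t)) = 1 / ln (1 - s) + 1 / s"
proof -
  have notin: "- complex_of_real s \<notin> complex_of_real ` {..-1}"
    using s by (auto simp: complex_eq_iff)
  have nz: "- complex_of_real s \<noteq> 0"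
    using s by simp
  have eq: "1 / ((- complex_of_real s + of_real t) * of_real (cut_weight t))
      = of_real (1 / ((t - s) * cut_weight t))" for t
    by simp
  have Ln: "Ln (1 + - complex_of_real s) = of_real (ln (1 - s))"
    using s Ln_of_real[of "1 - s"] by simp
  show int: "set_integrable lborel {1<..} (\<lambda>t. complex_of_real (1 / ((t - s) * cut_weight t)))"
    using inverse_Ln_integrable[OF notin] unfolding eq .
  then have "complex_integrable lborel (\<lambda>t. of_real
      (indicator {1<..} t *\<^sub>R (1 / ((t - s) * cut_weight t))))"
    by (simp only: set_integrable_def scaleR_conv_of_real of_real_mult of_real_eq_id id_apply)
  then show "set_integrable lborel {1<..} (\<lambda>t. 1 / ((t - s) * cut_weight t))"
    by (simp only: set_integrable_def complex_of_real_integrable_eq)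
  have "complex_of_real (LINT t:{1<..}|lborel. 1 / ((t - s) * cut_weight t))
     = 1 / of_real (ln (1 - s)) - 1 / - of_real s"
    using inverse_Ln_integral(2)[OF notin nz] unfolding eq Ln set_integral_complex_of_real .
  also have "\<dots> = of_real (1 / ln (1 - s) + 1 / s)"
    by simp
  finally have "complex_of_real (LINT t:{1<..}|lborel. 1 / ((t - s) * cut_weight t))
     = of_real (1 / ln (1 - s) + 1 / s)" .
  then show "(LINT t:{1<..}|lborel. 1 / ((t - s) * cut_weight t)) = 1 / ln (1 - s) + 1 / s"
    by (simp only: of_real_eq_iff)
qed

subsection \<open>Exchanging the order of integration\<close>

text \<open>
  As a function of \<open>s\<close>, this is the derivative of \<open>- Ln (1 + z/s) / Ln (1 + z)\<close>, extended
  continuously to \<open>z = 0\<close>.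
\<close>

definition log_quot_kernel :: "complex \<Rightarrow> real \<Rightarrow> complex"
  where "log_quot_kernel z s =
    (if z = 0 then 1 / (of_real s)\<^sup>2 else z / (of_real s * (z + of_real s) * Ln (1 + z)))"

text \<open>Separates 1 / (z + t) from 1 / (t - s), so that each summand in \<open>t\<close> is
  covered by one of the two integral formulas above.\<close>

lemma kernel_partial_fractions:
  fixes z s t W :: complex
  assumes "s \<noteq> 0" "z + s \<noteq> 0" "t - s \<noteq> 0" "z + t \<noteq> 0" "W \<noteq> 0"
  shows "t / (s * (t - s) * W) / (z + t)
      = z / (s * (z + s)) * (1 / ((z + t) * W)) + 1 / (z + s) * (1 / ((t - s) * W))"
proof -
  have "z * (t - s) + s * (z + t) = t * (z + s)"
    by (simp add: algebra_simps)
  then show ?thesis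
    using assms by (simp add: divide_simps)
qed

text \<open>After partial fractions the elementary terms -1/z and 1/s of the two formulas contribute
  opposite multiples of 1 / (s (z + s)) and cancel. At z = 0 only the second formula contributes,
  and its 1/s gives the value 1 / s^2 of \<open>log_quot_kernel\<close>.\<close>

lemma kernel_integral:
  fixes z :: complex
  assumes s: "0 < s" "s < 1" and z: "z \<notin> complex_of_real ` {..-s}"
  defines "f \<equiv> \<lambda>t. of_real (t / (s * (t - s) * cut_weight t)) / (z + of_real t)"
  shows "set_integrable lborel {1<..} f"
    and "(LINT t:{1<..}|lborel. f t) = log_quot_kernel z s + 1 / (of_real (ln (1 - s)) * (z + of_real s))"
proof -
  define A where "A = z / (of_real s * (z + of_real s))"
  define B where "B = 1 / (z + of_real s)"
  define f1 where "f1 t = 1 / ((z + of_real t) * of_real (cut_weight t))" for t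
  define f2 where "f2 t = 1 / ((t - s) * cut_weight t)" for t
  have z1: "z \<notin> complex_of_real ` {..-1}"
    using not_in_cut_mono[OF z] s by simp
  have zs: "z + of_real s \<noteq> 0"
    using not_in_cut_add_nonzero[OF z] by simp
  have f: "f t = A * f1 t + B * of_real (f2 t)" if "t \<in> {1<..}" for t
  proof -
    have "z + of_real t \<noteq> 0"
      using not_in_cut_add_nonzero[OF z] s that by simp
    moreover have "complex_of_real t - of_real s \<noteq> 0"
      using s that by auto
    moreover have "complex_of_real (cut_weight t) \<noteq> 0"
      using cut_weight_pos[of t] by simp
    ultimately show ?thesis
      using kernel_partial_fractions[of "of_real s" z "of_real t" "of_real (cut_weight t)"] s zs
      by (simp add: f_def A_def B_def f1_def f2_def)
  qed
  have i1: "set_integrable lborel {1<..} f1"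
    unfolding f1_def by (rule inverse_Ln_integrable[OF z1])
  have i2: "set_integrable lborel {1<..} (\<lambda>t. complex_of_real (f2 t))"
    unfolding f2_def by (rule inverse_ln_integrable_complex[OF s])
  have i: "set_integrable lborel {1<..} (\<lambda>t. A * f1 t + B * of_real (f2 t))"
    by (intro set_integral_add set_integrable_mult_right i1 i2)
  show "set_integrable lborel {1<..} f"
    using i by (subst set_integrable_cong[OF refl refl f]) auto
  have "(LINT t:{1<..}|lborel. f t) = (LINT t:{1<..}|lborel. A * f1 t + B * of_real (f2 t))"
    by (intro set_lebesgue_integral_cong) (auto simp: f)
  also have "\<dots> = A * (LINT t:{1<..}|lborel. f1 t) + B * (LINT t:{1<..}|lborel. of_real (f2 t))"
    by (subst set_integral_add(2)) (auto intro!: set_integrable_mult_right i1 i2)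
  also have "(LINT t:{1<..}|lborel. complex_of_real (f2 t)) = of_real (1 / ln (1 - s) + 1 / s)"
    unfolding f2_def set_integral_complex_of_real inverse_ln_integral(3)[OF s] ..
  \<comment> \<open>\<open>A\<close> vanishes at z = 0, the point where
    \<open>inverse_Ln_integral\<close> provides integrability but no value.\<close>
  also have "A * (LINT t:{1<..}|lborel. f1 t) =
      (if z = 0 then 0 else A * (1 / Ln (1 + z) - 1 / z))"
    using inverse_Ln_integral(2)[OF z1] by (simp add: A_def f1_def [abs_def])
  also have "\<dots> + B * of_real (1 / ln (1 - s) + 1 / s)
      = log_quot_kernel z s + 1 / (of_real (ln (1 - s)) * (z + of_real s))"
  proof (cases "z = 0")
    case True
    then show ?thesis
      using s by (simp add: B_def log_quot_kernel_def field_simps power2_eq_square)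
  next
    case False
    have alg: "z / (s * (z + s)) * (M - 1 / z) + 1 / (z + s) * (l + 1 / s) = z / (s * (z + s)) * M + l * (1 / (z + s))"
      if "z \<noteq> 0" "s \<noteq> 0" "z + s \<noteq> 0" for z s M l :: complex
      using that by (simp add: divide_simps)
    show ?thesis
      using alg[of z "of_real s" "1 / Ln (1 + z)" "1 / of_real (ln (1 - s))"] False s zs
      by (simp add: A_def B_def log_quot_kernel_def)
  qed
  finally show "(LINT t:{1<..}|lborel. f t) = log_quot_kernel z s + 1 / (of_real (ln (1 - s)) * (z + of_real s))" .
qed

text \<open>The z = 0 case of the integrand in \<open>kernel_integral\<close>, extended by zero to
  the plane so that Fubini applies on a product of full Lebesgue measures. General \<open>z\<close>
  is recovered through the factor t / (z + t).\<close>

definition product_kernel :: "real \<Rightarrow> real \<Rightarrow> real \<Rightarrow> real"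
  where "product_kernel a s t = indicator {a..<1} s * (indicator {1<..} t * (1 / (s * (t - s) * cut_weight t)))"

lemma borel_measurable_product_kernel [measurable]:
  "case_prod (product_kernel a) \<in> borel_measurable (lborel \<Otimes>\<^sub>M lborel)"
  unfolding product_kernel_def by measurable

lemma product_kernel_nonneg: "0 < a \<Longrightarrow> product_kernel a s t \<ge> 0"
  using cut_weight_pos[of t] by (auto simp: product_kernel_def split: split_indicator)

lemma product_kernel_section:
  assumes "0 < a" "a \<le> s" "s < 1"
  shows "integrable lborel (product_kernel a s)"
    and "integral\<^sup>L lborel (product_kernel a s) = 1 / s\<^sup>2 + 1 / (s * ln (1 - s))"
proof -
  have s: "0 < s" "s < 1"
    using assms by linarith+
  have eq: "product_kernel a s = (\<lambda>t. 1 / s * (indicator {1<..} t *\<^sub>R (1 / ((t - s) * cut_weight t))))"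
    using assms by (auto simp: product_kernel_def fun_eq_iff)
  show "integrable lborel (product_kernel a s)"
    unfolding eq using inverse_ln_integrable[OF s] unfolding set_integrable_def
    by (intro integrable_mult_right)
  show "integral\<^sup>L lborel (product_kernel a s) = 1 / s\<^sup>2 + 1 / (s * ln (1 - s))"
    unfolding eq integral_mult_right_zero
    using inverse_ln_integral(3)[OF s] s
    by (simp add: set_lebesgue_integral_def distrib_left power2_eq_square)
qed

text \<open>The kernel is nonnegative, so its inner integrals decide. By
  \<open>product_kernel_section\<close> they equal 1 / s^2 plus a term that is nonpositive because
  ln (1 - s) is negative; hence they are at most 1 / a^2 on a bounded interval.\<close>

lemma integrable_product_kernel:
  assumes a: "0 < a"
  shows "integrable (lborel \<Otimes>\<^sub>M lborel) (case_prod (product_kernel a))"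
proof (rule lborel_pair.Fubini_integrable)
  have zero: "product_kernel a s = (\<lambda>t. 0)" if "\<not> (a \<le> s \<and> s < 1)" for s
    using that by (auto simp: product_kernel_def fun_eq_iff)
  have int: "integrable lborel (product_kernel a s)" for s
    using product_kernel_section(1)[OF a] zero[of s] by (cases "a \<le> s \<and> s < 1") auto
  then show "AE s in lborel. integrable lborel (\<lambda>t. case (s, t) of (s, t) \<Rightarrow> product_kernel a s t)"
    by simp
  show "integrable lborel (\<lambda>s. LINT t|lborel. norm (case (s, t) of (s, t) \<Rightarrow> product_kernel a s t))"
  proof (rule Bochner_Integration.integrable_bound)
    show "integrable lborel (\<lambda>s. indicator {a..1} s *\<^sub>R (1 / a\<^sup>2))"
      using borel_integrable_atLeastAtMost'[OF continuous_on_const] unfolding set_integrable_def .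
    show "AE s in lborel. norm (LINT t|lborel. norm (case (s, t) of (s, t) \<Rightarrow> product_kernel a s t))
        \<le> norm (indicator {a..1} s *\<^sub>R (1 / a\<^sup>2))"
    proof (intro AE_I2)
      fix s :: real
      have "(LINT t|lborel. norm (case (s, t) of (s, t) \<Rightarrow> product_kernel a s t)) = integral\<^sup>L lborel (product_kernel a s)"
        using product_kernel_nonneg[OF a] by simp
      moreover have "0 \<le> integral\<^sup>L lborel (product_kernel a s)"
        by (intro integral_nonneg_AE AE_I2 product_kernel_nonneg a)
      moreover have "integral\<^sup>L lborel (product_kernel a s) \<le> indicator {a..1} s *\<^sub>R (1 / a\<^sup>2)"
      proof (cases "a \<le> s \<and> s < 1")
        case True
        then have "s * ln (1 - s) \<le> 0"
          using a by (intro mult_nonneg_nonpos) auto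
        then have "1 / (s * ln (1 - s)) \<le> 0"
          by (simp add: divide_nonneg_nonpos)
        moreover have "1 / s\<^sup>2 \<le> 1 / a\<^sup>2"
          using True a by (intro frac_le power_mono) auto
        moreover have "integral\<^sup>L lborel (product_kernel a s) = 1 / s\<^sup>2 + 1 / (s * ln (1 - s))"
          using True by (intro product_kernel_section(2) a) auto
        moreover have "indicator {a..1} s *\<^sub>R (1 / a\<^sup>2) = 1 / a\<^sup>2"
          using True by simp
        ultimately show ?thesis
          by linarith
      next
        case False
        then show ?thesis
          by (simp add: zero)
      qed
      ultimately show "norm (LINT t|lborel. norm (case (s, t) of (s, t) \<Rightarrow> product_kernel a s t))
        \<le> norm (indicator {a..1} s *\<^sub>R (1 / a\<^sup>2))"
        by simp
    qed
  qed measurable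
qed measurable

text \<open>Reconciles the half-open interval of the density's first branch with the closed interval
  needed for the fundamental theorem of calculus; the endpoint is a null set.\<close>

lemma integral_Ico_eq_Icc:
  fixes f :: "real \<Rightarrow> 'a::{banach, second_countable_topology}"
  assumes "continuous_on {a..b} f"
  shows "integrable lborel (\<lambda>s. indicator {a..<b} s *\<^sub>R f s)"
    and "(LINT s|lborel. indicator {a..<b} s *\<^sub>R f s) = (LINT s|lborel. indicator {a..b} s *\<^sub>R f s)"
proof -
  have int: "set_integrable lborel {a..b} f"
    by (rule borel_integrable_atLeastAtMost') (rule assms)
  then have "set_integrable lborel {a..<b} f"
    by (rule set_integrable_subset) auto
  then show int': "integrable lborel (\<lambda>s. indicator {a..<b} s *\<^sub>R f s)"
    by (simp only: set_integrable_def)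
  show "(LINT s|lborel. indicator {a..<b} s *\<^sub>R f s) = (LINT s|lborel. indicator {a..b} s *\<^sub>R f s)"
  proof (rule integral_cong_AE)
    show "AE s in lborel. indicator {a..<b} s *\<^sub>R f s = indicator {a..b} s *\<^sub>R f s"
      using AE_lborel_singleton[of b] by eventually_elim (auto simp: indicator_def)
  qed (use int int' in \<open>auto simp: set_integrable_def\<close>)
qed

text \<open>In \<open>s\<close>, the primitive of 1 / (s (t - s)) is (ln s - ln (t - s)) / t. Its
  increment from 1/r to 1 is the logarithm in the density on t > 1, divided by t.\<close>

lemma product_kernel_integral_fst:
  assumes r: "r > 1" and t: "t > 1"
  shows "(LINT s|lborel. product_kernel (1 / r) s t) = log_ratio_density r t / t"
proof -
  define W where "W = cut_weight t"
  have a: "0 < 1 / r" "1 / r < 1"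
    using r by auto
  have cont: "continuous_on {1 / r..1} (\<lambda>s. 1 / (s * (t - s)))"
    using a t by (intro continuous_intros) auto
  have "(LINT s|lborel. product_kernel (1 / r) s t)
      = (LINT s|lborel. (indicator {1 / r..<1} s *\<^sub>R (1 / (s * (t - s)))) * (1 / W))"
    using t by (intro Bochner_Integration.integral_cong refl) (auto simp: product_kernel_def W_def)
  also have "\<dots> = (LINT s|lborel. indicator {1 / r..1} s *\<^sub>R (1 / (s * (t - s)))) * (1 / W)"
    unfolding integral_mult_left_zero integral_Ico_eq_Icc(2)[OF cont] ..
  also have "(LINT s|lborel. indicator {1 / r..1} s *\<^sub>R (1 / (s * (t - s))))
      = (ln 1 - ln (t - 1)) / t - (ln (1 / r) - ln (t - 1 / r)) / t"
  proof (rule integral_FTC_atLeastAtMost[where F = "\<lambda>s. (ln s - ln (t - s)) / t"])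
    fix s
    assume s: "1 / r \<le> s" "s \<le> 1"
    then have pos: "0 < s" "s < t"
      using a t by linarith+
    then have "((\<lambda>s. (ln s - ln (t - s)) / t) has_real_derivative 1 / (s * (t - s))) (at s within {1 / r..1})"
      by (auto intro!: derivative_eq_intros simp: divide_simps)
    then show "((\<lambda>s. (ln s - ln (t - s)) / t) has_vector_derivative 1 / (s * (t - s))) (at s within {1 / r..1})"
      by (simp only: has_real_derivative_iff_has_vector_derivative)
  qed (use a cont in auto)
  also have "\<dots> = ln ((r * t - 1) / (t - 1)) / t"
  proof -
    have rt: "r * t - 1 > 0"
      using r t by (smt (verit) mult_less_cancel_left2)
    have "t - 1 / r = (r * t - 1) / r"
      using r by (simp add: field_simps)
    then have "ln (t - 1 / r) = ln (r * t - 1) - ln r"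
      using rt r by (simp add: ln_div)
    moreover have "ln (1 / r) = - ln r"
      using r by (simp add: ln_div)
    moreover have "ln ((r * t - 1) / (t - 1)) = ln (r * t - 1) - ln (t - 1)"
      using rt t by (simp add: ln_div)
    ultimately show ?thesis
      by (simp add: diff_divide_distrib)
  qed
  finally show ?thesis
    using t by (simp add: log_ratio_density_def W_def cut_weight_def)
qed

text \<open>For z \<noteq> 0 the primitive - Ln (1 + z/s) / Ln (1 + z) equals -1 at s = 1 and minus
  the log ratio at s = 1/r. For z = 0 the primitive -1/s yields r - 1, the same formula with the
  removable value.\<close>

lemma log_quot_kernel_integral:
  fixes z :: complex
  assumes r: "r > 1" and z: "z \<notin> complex_of_real ` {..- (1 / r)}"
  shows "integrable lborel (\<lambda>s. indicator {1 / r..<1} s *\<^sub>R log_quot_kernel z s)"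
    and "(LINT s|lborel. indicator {1 / r..<1} s *\<^sub>R log_quot_kernel z s) = log_ratio r z - 1"
proof -
  have a: "0 < 1 / r" "1 / r < 1"
    using r by auto
  \<comment> \<open>If 1 + z/s were a real x \<le> 0, then z = (x - 1) s \<le> -s \<le> -1/r would
    lie on the cut. So the primitive never meets the branch cut of \<open>Ln\<close>.\<close>
  have z1: "1 + z / of_real s \<notin> \<real>\<^sub>\<le>\<^sub>0" if "1 / r \<le> s" for s
  proof
    assume "1 + z / of_real s \<in> \<real>\<^sub>\<le>\<^sub>0"
    then obtain x where x: "x \<le> 0" "1 + z / of_real s = of_real x"
      by (auto elim!: nonpos_Reals_cases)
    have s: "s > 0"
      using that a by linarith
    have "z / of_real s = of_real (x - 1)"
      using x(2) by (simp add: eq_diff_eq add.commute)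
    then have "z = of_real ((x - 1) * s)"
      using s by (simp add: divide_eq_eq)
    moreover have "(x - 1) * s \<le> - (1 / r)"
    proof -
      have "x * s \<le> 0"
        using x(1) s by (simp add: mult_nonpos_nonneg)
      then show ?thesis
        using that by (simp add: left_diff_distrib)
    qed
    ultimately show False
      using z by blast
  qed
  have zs: "z + of_real s \<noteq> 0" if "1 / r \<le> s" for s
    by (rule not_in_cut_add_nonzero[OF z that])
  have Ln: "Ln (1 + z) \<noteq> 0" if "z \<noteq> 0"
  proof
    have "1 + z \<noteq> 0"
      using zs[of 1] a by (simp add: add.commute)
    moreover assume "Ln (1 + z) = 0"
    ultimately have "1 + z = exp 0"
      by (metis exp_Ln)
    with that show False
      by simp
  qed
  have cont: "continuous_on {1 / r..1} (log_quot_kernel z)"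
  proof (cases "z = 0")
    case True
    then show ?thesis
      using a unfolding log_quot_kernel_def by (auto intro!: continuous_intros)
  next
    case False
    then show ?thesis
      using a zs Ln unfolding log_quot_kernel_def by (auto intro!: continuous_intros)
  qed
  show "integrable lborel (\<lambda>s. indicator {1 / r..<1} s *\<^sub>R log_quot_kernel z s)"
    by (rule integral_Ico_eq_Icc(1)[OF cont])
  define G where "G s = (if z = 0 then - 1 / of_real s else - Ln (1 + z / of_real s) / Ln (1 + z))" for s :: real
  have deriv: "(G has_vector_derivative log_quot_kernel z s) (at s within {1 / r..1})"
    if s: "1 / r \<le> s" for s
  proof -
    \<comment> \<open>\<open>H\<close> extends \<open>G\<close> to a complex argument, so that it
      can be differentiated holomorphically before restricting to the real line.\<close>
    define H where "H u = (if z = 0 then - 1 / u else - Ln (1 + z / u) / Ln (1 + z))" for u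
    have s0: "s > 0"
      using s a by linarith
    have "(H has_field_derivative log_quot_kernel z s) (at (of_real s))"
    proof (cases "z = 0")
      case True
      have "((\<lambda>u. - 1 / u) has_field_derivative 1 / (complex_of_real s)\<^sup>2) (at (of_real s))"
        using s0 by (auto intro!: derivative_eq_intros simp: power2_eq_square divide_simps)
      with True show ?thesis
        by (simp add: H_def [abs_def] log_quot_kernel_def)
    next
      case False
      define c where "c = Ln (1 + z)"
      have c: "c \<noteq> 0"
        using Ln False by (simp add: c_def)
      have nz: "1 + z / of_real s \<noteq> 0"
        using z1[OF s] by auto
      have "((\<lambda>u. 1 + z / u) has_field_derivative - z / (of_real s)\<^sup>2) (at (of_real s))"
        using s0 by (auto intro!: derivative_eq_intros simp: power2_eq_square)
      note DERIV_chain2[OF has_field_derivative_Ln[OF z1[OF s]] this]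
      then have "((\<lambda>u. - Ln (1 + z / u) / c) has_field_derivative
          - (inverse (1 + z / of_real s) * (- z / (of_real s)\<^sup>2)) / c) (at (of_real s))"
        by (intro DERIV_cdivide DERIV_minus)
      also have "- (inverse (1 + z / of_real s) * (- z / (of_real s)\<^sup>2)) / c
          = z / (of_real s * (z + of_real s) * c)"
        using s0 nz c zs[OF s] by (simp add: power2_eq_square divide_simps add.commute)
      finally show ?thesis
        using False by (simp add: H_def [abs_def] log_quot_kernel_def c_def)
    qed
    then have "((\<lambda>x. H (of_real x)) has_vector_derivative log_quot_kernel z s) (at s within {1 / r..1})"
      by (rule has_vector_derivative_real_field)
    then show ?thesis
      by (simp add: H_def G_def [abs_def])
  qed
  have "(LINT s|lborel. indicator {1 / r..<1} s *\<^sub>R log_quot_kernel z s) = G 1 - G (1 / r)"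
    unfolding integral_Ico_eq_Icc(2)[OF cont]
    by (rule integral_FTC_atLeastAtMost) (use a deriv cont in auto)
  also have "\<dots> = log_ratio r z - 1"
    using Ln by (auto simp: G_def log_ratio_def mult.commute)
  finally show "(LINT s|lborel. indicator {1 / r..<1} s *\<^sub>R log_quot_kernel z s) = log_ratio r z - 1" .
qed

text \<open>Integrating \<open>F\<close> first over \<open>t\<close> leaves \<open>K + g1\<close>,
  first over \<open>s\<close> leaves \<open>g2\<close>. Since \<open>K\<close> integrates to the log
  ratio minus 1, Fubini expresses the latter as the integral of \<open>g2 - g1\<close>, whose two
  terms carry the branches of the density on (1, \<infinity>) and on [1/r, 1).\<close>

lemma log_ratio_integral:
  fixes z :: complex
  assumes r: "r > 1" and z: "z \<notin> complex_of_real ` {..- (1 / r)}"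
  defines "g \<equiv> \<lambda>t. of_real (log_ratio_density r t) / (z + of_real t)"
  shows "set_integrable lborel {1 / r..} g"
    and "log_ratio r z = 1 + (LINT t:{1 / r..}|lborel. g t)"
proof -
  let ?a = "1 / r"
  have a: "0 < ?a" "?a < 1"
    using r by auto
  obtain C where C: "C > 0" "\<And>t. t \<ge> ?a \<Longrightarrow> \<bar>t\<bar> \<le> C * norm (z + of_real t)"
    using norm_le_dist_cut[OF z] by blast
  have zt: "norm (z + of_real t) > 0" if "?a \<le> t" for t
    using not_in_cut_add_nonzero[OF z that] by simp
  have C': "t / norm (z + of_real t) \<le> C" if "?a \<le> t" for t
    using C(2)[OF that] zt[OF that] by (simp add: divide_le_eq)

  \<comment> \<open>For t > 1 the added factor has modulus at most \<open>C\<close>, so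
    \<open>F\<close> is dominated by \<open>C\<close> times the positive kernel.\<close>
  define F where "F s t = of_real (product_kernel ?a s t) * (of_real t / (z + of_real t))" for s t
  have F_int: "integrable (lborel \<Otimes>\<^sub>M lborel) (case_prod F)"
  proof (rule Bochner_Integration.integrable_bound)
    show "integrable (lborel \<Otimes>\<^sub>M lborel) (\<lambda>p. C * case_prod (product_kernel ?a) p)"
      by (intro integrable_mult_right integrable_product_kernel a)
    have "(\<lambda>p. of_real (case_prod (product_kernel ?a) p) * (of_real (snd p) / (z + of_real (snd p))))
        \<in> borel_measurable (lborel \<Otimes>\<^sub>M lborel)"
      by measurable
    then show "case_prod F \<in> borel_measurable (lborel \<Otimes>\<^sub>M lborel)"
      by (simp add: F_def split_beta')
    show "AE p in lborel \<Otimes>\<^sub>M lborel. norm (case_prod F p) \<le> norm (C * case_prod (product_kernel ?a) p)"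
    proof (intro AE_I2)
      fix p :: "real \<times> real"
      obtain s t where p: "p = (s, t)"
        by (cases p)
      have pk: "product_kernel ?a s t \<ge> 0"
        by (rule product_kernel_nonneg) (rule a)
      have "norm (F s t) \<le> C * product_kernel ?a s t"
      proof (cases "t > 1")
        case True
        then have "?a \<le> t"
          using a by linarith
        then have "t / norm (z + of_real t) \<le> C"
          by (rule C')
        then have "product_kernel ?a s t * (t / norm (z + of_real t)) \<le> product_kernel ?a s t * C"
          using pk by (rule mult_left_mono)
        then show ?thesis
          using pk True by (simp add: F_def norm_mult norm_divide mult.commute)
      next
        case False
        then have "product_kernel ?a s t = 0"
          by (simp add: product_kernel_def)
        then show ?thesis
          by (simp add: F_def)
      qed
      then show "norm (case_prod F p) \<le> norm (C * case_prod (product_kernel ?a) p)"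
        using pk C(1) by (simp add: p)
    qed
  qed

  define K where "K s = indicator {?a..<1} s *\<^sub>R log_quot_kernel z s" for s
  define g1 where "g1 s = indicator {?a..<1} s *\<^sub>R (1 / (of_real (ln (1 - s)) * (z + of_real s)))" for s
  define g2 where "g2 t = indicator {1<..} t *\<^sub>R g t" for t
  have F_snd: "(LINT t|lborel. F s t) = K s + g1 s" for s
  proof (cases "?a \<le> s \<and> s < 1")
    case True
    then have s: "0 < s" "s < 1"
      using a by linarith+
    have zs: "z \<notin> complex_of_real ` {..-s}"
      using not_in_cut_mono[OF z] True by simp
    have "(LINT t|lborel. F s t) = (LINT t:{1<..}|lborel. of_real (t / (s * (t - s) * cut_weight t)) / (z + of_real t))"
      unfolding set_lebesgue_integral_def using True
      by (intro Bochner_Integration.integral_cong refl)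
         (simp add: F_def product_kernel_def split: split_indicator)
    also have "\<dots> = K s + g1 s"
      unfolding kernel_integral(2)[OF s zs] using True by (simp add: K_def g1_def)
    finally show ?thesis .
  next
    case False
    then have "F s t = 0" for t
      by (auto simp: F_def product_kernel_def split: split_indicator)
    then show ?thesis
      using False by (auto simp: K_def g1_def)
  qed
  have F_fst: "(LINT s|lborel. F s t) = g2 t" for t
  proof (cases "t > 1")
    case True
    have "(LINT s|lborel. F s t) = of_real (LINT s|lborel. product_kernel ?a s t) * (of_real t / (z + of_real t))"
      unfolding F_def integral_mult_left_zero integral_complex_of_real ..
    then show ?thesis
      using True product_kernel_integral_fst[OF r True] by (simp add: g2_def g_def)
  next
    case False
    then show ?thesis
      by (simp add: F_def product_kernel_def g2_def)
  qed
  have g2_int: "integrable lborel g2"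
    using lborel_pair.integrable_snd[OF F_int] by (simp add: F_fst)
  have K_int: "integrable lborel K" "integral\<^sup>L lborel K = log_ratio r z - 1"
    unfolding K_def using log_quot_kernel_integral[OF r z] by simp_all
  have Kg1_int: "integrable lborel (\<lambda>s. K s + g1 s)"
    using lborel_pair.integrable_fst[OF F_int] by (simp add: F_snd)
  \<comment> \<open>The singular-looking \<open>g1\<close> needs no estimate of its own: Fubini
    gives integrability of \<open>K + g1\<close>, and \<open>K\<close> is integrable.\<close>
  have g1_int: "integrable lborel g1"
    using Bochner_Integration.integrable_diff[OF Kg1_int K_int(1)] by simp
  have "integral\<^sup>L lborel g2 = integral\<^sup>L lborel (\<lambda>s. K s + g1 s)"
    using lborel_pair.Fubini_integral[OF F_int] by (simp add: F_fst F_snd)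
  also have "\<dots> = (log_ratio r z - 1) + integral\<^sup>L lborel g1"
    using K_int g1_int by simp
  finally have eq: "log_ratio r z = 1 + (integral\<^sup>L lborel g2 - integral\<^sup>L lborel g1)"
    by simp
  \<comment> \<open>The minus sign matches -1 / ln (1 - t) in the density. At t = 1 both indicators
    vanish, in agreement with the value 0 there.\<close>
  have split: "indicator {?a..} t *\<^sub>R g t = g2 t - g1 t" for t
  proof -
    define b where "b = ?a"
    have "b < 1"
      using a by (simp add: b_def)
    then show ?thesis
      unfolding g1_def g2_def g_def b_def [symmetric]
      by (auto simp: log_ratio_density_def split: split_indicator)
  qed
  show "set_integrable lborel {?a..} g"
    unfolding set_integrable_def split using g1_int g2_int by simp
  show "log_ratio r z = 1 + (LINT t:{?a..}|lborel. g t)"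
    unfolding set_lebesgue_integral_def split using eq g1_int g2_int by simp
qed

subsection \<open>Consequences of the integral representation\<close>

lemma borel_measurable_log_ratio_density [measurable]: "log_ratio_density r \<in> borel_measurable borel"
  unfolding log_ratio_density_def by measurable

lemma log_ratio_integral_real:
  fixes x :: real
  assumes r: "r > 1" and x: "x > - (1 / r)"
  defines "g \<equiv> \<lambda>t. log_ratio_density r t / (x + t)"
  shows "set_integrable lborel {1 / r..} g"
    and "log_ratio r (of_real x) = of_real (1 + (LINT t:{1 / r..}|lborel. g t))"
proof -
  have z: "complex_of_real x \<notin> complex_of_real ` {..- (1 / r)}"
    using x by auto
  have eq: "of_real (log_ratio_density r t) / (complex_of_real x + of_real t) = of_real (g t)" for t
    by (simp add: g_def)
  have "complex_integrable lborel (\<lambda>t. of_real (indicator {1 / r..} t *\<^sub>R g t))"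
    using log_ratio_integral(1)[OF r z] unfolding eq
    by (simp only: set_integrable_def scaleR_conv_of_real of_real_mult of_real_eq_id id_apply)
  then show "set_integrable lborel {1 / r..} g"
    by (simp only: set_integrable_def complex_of_real_integrable_eq)
  show "log_ratio r (of_real x) = of_real (1 + (LINT t:{1 / r..}|lborel. g t))"
    using log_ratio_integral(2)[OF r z] unfolding eq set_integral_complex_of_real by simp
qed

lemma log_ratio_density_pos:
  assumes "r > 1" "1 / r \<le> t" "t < 1"
  shows "log_ratio_density r t > 0"
proof -
  have "t > 0"
    using assms by (smt (verit) divide_pos_pos)
  then have "ln (1 - t) < 0"
    using assms by simp
  then show ?thesis
    using assms by (simp add: log_ratio_density_def divide_neg_neg)
qed

text \<open>A nonnegative integrand with zero integral vanishes almost everywhere, but this one is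
  positive on (1/r, 1), a set of positive measure. Both strict inequalities below follow from it by
  choosing \<phi>.\<close>

lemma log_ratio_density_integral_pos:
  fixes \<phi> :: "real \<Rightarrow> real"
  assumes r: "r > 1" and \<phi>: "\<And>t. t \<ge> 1 / r \<Longrightarrow> \<phi> t > 0"
    and int: "set_integrable lborel {1 / r..} (\<lambda>t. log_ratio_density r t * \<phi> t)"
  shows "(LINT t:{1 / r..}|lborel. log_ratio_density r t * \<phi> t) > 0"
proof (rule ccontr)
  let ?f = "\<lambda>t. indicator {1 / r..} t *\<^sub>R (log_ratio_density r t * \<phi> t)"
  have f: "integrable lborel ?f"
    using int by (simp only: set_integrable_def)
  have nonneg: "?f t \<ge> 0" for t
  proof (cases "t \<ge> 1 / r")
    case True
    have "log_ratio_density r t * \<phi> t \<ge> 0"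
      using log_ratio_density_nonneg[OF r True] \<phi>[OF True] by simp
    then show ?thesis
      by (simp add: indicator_def)
  qed simp
  assume "\<not> (LINT t:{1 / r..}|lborel. log_ratio_density r t * \<phi> t) > 0"
  then have "integral\<^sup>L lborel ?f \<le> 0"
    by (simp add: set_lebesgue_integral_def)
  moreover have "integral\<^sup>L lborel ?f \<ge> 0"
    by (rule integral_nonneg_AE) (rule AE_I2, rule nonneg)
  ultimately have "AE t in lborel. ?f t = 0"
    using integral_nonneg_eq_0_iff_AE[OF f AE_I2[OF nonneg]] by linarith
  then have "AE t in lborel. t \<notin> {1 / r<..<1}"
  proof eventually_elim
    case (elim t)
    show ?case
    proof
      assume t: "t \<in> {1 / r<..<1}"
      then have "log_ratio_density r t * \<phi> t > 0"
        using log_ratio_density_pos[OF r] \<phi> by (intro mult_pos_pos) auto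
      moreover have ind: "indicator {1 / r..} t = (1::real)"
        using t by (simp add: indicator_def)
      ultimately show False
        using elim[unfolded ind scaleR_one] by linarith
    qed
  qed
  then have "{1 / r<..<1} \<in> null_sets lborel"
    by (subst AE_iff_null_sets) auto
  then have "emeasure lborel {1 / r<..<1} = 0"
    by (rule null_setsD1)
  then show False
    using r by simp
qed

text \<open>After clearing denominators the gap is exactly u v (a - b)^2.\<close>

lemma inverse_strictly_convex:
  fixes a b u v :: real
  assumes "a > 0" "b > 0" "a \<noteq> b" "u > 0" "v > 0" "u + v = 1"
  shows "1 / (u * a + v * b) < u / a + v / b"
proof -
  have "(a - b)\<^sup>2 > 0"
    using assms by simp
  then have pos: "u * v * (a - b)\<^sup>2 > 0"
    using assms by simp
  have v: "v = 1 - u"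
    using assms by simp
  have "(u * b + v * a) * (u * a + v * b) = a * b + u * v * (a - b)\<^sup>2"
    unfolding v by (simp add: algebra_simps power2_eq_square)
  then have "a * b < (u * b + v * a) * (u * a + v * b)"
    using pos by linarith
  moreover have "u * a + v * b > 0"
    using assms by (simp add: add_pos_pos)
  ultimately have "1 / (u * a + v * b) < (u * b + v * a) / (a * b)"
    using assms by (simp add: divide_simps)
  also have "\<dots> = u / a + v / b"
    using assms by (simp add: field_simps)
  finally show ?thesis .
qed

section \<open>Real values and limits at the ends of the interval\<close>

lemma Re_log_ratio_of_real:
  assumes "r > 1" "x > - (1 / r)" "x \<noteq> 0"
  shows "Re (log_ratio r (of_real x)) = ln (1 + r * x) / ln (1 + x)"
proof -
  have "1 + r * x > 0"
    using assms by (simp add: field_simps)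
  moreover have "1 / r < 1"
    using assms by simp
  then have "1 + x > 0"
    using assms(2) by linarith
  ultimately have "Ln (of_real (1 + r * x)) = of_real (ln (1 + r * x))"
      "Ln (of_real (1 + x)) = of_real (ln (1 + x))"
    by (simp_all only: Ln_of_real)
  moreover have "log_ratio r (of_real x) = Ln (of_real (1 + r * x)) / Ln (of_real (1 + x))"
    using assms by (simp add: log_ratio_def)
  ultimately have "log_ratio r (of_real x) = of_real (ln (1 + r * x) / ln (1 + x))"
    by (simp only: of_real_divide)
  then show ?thesis
    by (simp only: Re_complex_of_real)
qed

lemma log_ratio_tendsto_1:
  assumes r: "r > 1"
  shows "((\<lambda>x. Re (log_ratio r (complex_of_real x))) \<longlongrightarrow> 1) at_top"
proof -
  have "((\<lambda>x. ln (1 + r * x) / ln (1 + x)) \<longlongrightarrow> 1) at_top"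
    using r by real_asymp
  moreover have "eventually (\<lambda>x. ln (1 + r * x) / ln (1 + x) = Re (log_ratio r (complex_of_real x))) at_top"
    using eventually_gt_at_top[of 0]
  proof eventually_elim
    case (elim x)
    have "- (1 / r) < 0"
      using r by simp
    then show ?case
      using elim by (intro Re_log_ratio_of_real[symmetric] r) linarith+
  qed
  ultimately show ?thesis
    by (rule Lim_transform_eventually)
qed

text \<open>As x decreases to -1/r the numerator ln (1 + r x) tends to -\<infinity>, while ln (1 +
  x) tends to the negative number ln (1 - 1/r). Two signs are inserted to obtain a positive limit
  times a factor tending to +\<infinity>.\<close>

lemma log_ratio_at_left_end:
  assumes r: "r > 1"
  shows "filterlim (\<lambda>x. Re (log_ratio r (complex_of_real x))) at_top (at_right (- (1 / r)))"
proof -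
  have lin: "filterlim (\<lambda>x. 1 + r * x) (at_right 0) (at_right (- (1 / r)))"
  proof -
    have "((\<lambda>x. 1 + r * x) \<longlongrightarrow> 1 + r * (- (1 / r))) (at_right (- (1 / r)))"
      by (intro tendsto_intros)
    moreover have "eventually (\<lambda>x. 1 + r * x \<in> {0<..}) (at_right (- (1 / r)))"
      using eventually_at_right_less[of "- (1 / r)"]
      by eventually_elim (use r in \<open>simp add: field_simps\<close>)
    ultimately show ?thesis
      using r by (auto simp: filterlim_at elim: eventually_mono)
  qed
  have "filterlim (\<lambda>x. ln (1 + r * x)) at_bot (at_right (- (1 / r)))"
    by (rule filterlim_compose[OF ln_at_0 lin])
  then have num: "filterlim (\<lambda>x. - ln (1 + r * x)) at_top (at_right (- (1 / r)))"
    by (simp add: filterlim_uminus_at_bot)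
  have neg: "ln (1 + - (1 / r)) < 0" "1 + - (1 / r) > 0"
    using r by simp_all
  have den: "((\<lambda>x. - 1 / ln (1 + x)) \<longlongrightarrow> - 1 / ln (1 + - (1 / r))) (at_right (- (1 / r)))"
    using neg by (intro tendsto_intros) auto
  have "filterlim (\<lambda>x. - 1 / ln (1 + x) * - ln (1 + r * x)) at_top (at_right (- (1 / r)))"
    by (rule filterlim_tendsto_pos_mult_at_top[OF den _ num]) (use neg in \<open>simp add: divide_neg_neg\<close>)
  moreover have "eventually (\<lambda>x. - 1 / ln (1 + x) * - ln (1 + r * x) = Re (log_ratio r (complex_of_real x)))
      (at_right (- (1 / r)))"
  proof -
    \<comment> \<open>Staying left of 0 avoids the removable singularity, where the quotient of real
      logarithms is not the value of \<open>log_ratio\<close>.\<close>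
    have "- (1 / r) < 0"
      using r by simp
    then have "eventually (\<lambda>x. x \<in> {- (1 / r)<..<0}) (at_right (- (1 / r)))"
      by (rule eventually_at_right_real)
    then show ?thesis
      by eventually_elim (use r in \<open>simp add: Re_log_ratio_of_real\<close>)
  qed
  ultimately show ?thesis
    using filterlim_cong[OF refl refl] by fast
qed

text \<open>The constant is 1 and the measure has the density \<open>log_ratio_density r\<close> on
  [1/r, \<infinity>), extended by zero to [0, \<infinity>). Nonnegativity of the density makes the
  passage through \<open>ennreal\<close> faithful.\<close>

lemma stieltjes_log_ratio:
  assumes r: "r > 1"
  shows "stieltjes_function (\<lambda>x. Re (log_ratio r (complex_of_real x)))"
proof -
  define \<mu> where "\<mu> = density (restrict_space lborel {0..}) (\<lambda>t. ennreal (indicator {1 / r..} t * log_ratio_density r t))"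
  have sets: "sets \<mu> = sets (restrict_space borel {0..})"
    unfolding \<mu>_def sets_density by (intro sets_restrict_space_cong) simp
  have r0: "1 / r > 0"
    using r by simp
  have w: "indicator {1 / r..} t * log_ratio_density r t \<ge> 0" for t
    using log_ratio_density_nonneg[OF r, of t] by (simp add: indicator_def)
  have meas [measurable]: "(\<lambda>t. indicator {1 / r..} t * log_ratio_density r t)
      \<in> borel_measurable (restrict_space lborel {0..})"
    by (rule measurable_restrict_space1) measurable
  have meas' [measurable]: "(\<lambda>t. 1 / (x + t)) \<in> borel_measurable (restrict_space lborel {0..})" for x :: real
    by (rule measurable_restrict_space1) measurable
  have eq: "(indicator {0..} t * (indicator {1 / r..} t * log_ratio_density r t)) *\<^sub>R (1 / (x + t))
      = indicator {1 / r..} t *\<^sub>R (log_ratio_density r t / (x + t))" for x t :: real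
  proof (cases "1 / r \<le> t")
    case True
    then have "0 \<le> t"
      using r0 by linarith
    with True show ?thesis
      by simp
  qed simp
  have "integrable \<mu> (\<lambda>t. 1 / (x + t)) \<and>
      Re (log_ratio r (complex_of_real x)) = 1 + (LINT t|\<mu>. 1 / (x + t))" if x: "x > 0" for x
  proof
    have x': "x > - (1 / r)"
      using x r0 by linarith
    show "integrable \<mu> (\<lambda>t. 1 / (x + t))"
      unfolding \<mu>_def using log_ratio_integral_real(1)[OF r x']
      by (subst integrable_density)
         (auto simp: w integrable_restrict_space eq set_integrable_def simp del: real_scaleR_def)
    have "(LINT t|\<mu>. 1 / (x + t)) = (LINT t:{1 / r..}|lborel. log_ratio_density r t / (x + t))"
      unfolding \<mu>_def
      by (subst integral_density)
         (auto simp: w integral_restrict_space eq set_lebesgue_integral_def simp del: real_scaleR_def)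
    then show "Re (log_ratio r (complex_of_real x)) = 1 + (LINT t|\<mu>. 1 / (x + t))"
      unfolding log_ratio_integral_real(2)[OF r x'] by simp
  qed
  then show ?thesis
    unfolding stieltjes_function_def using sets
    by (intro exI[of _ 1] exI[of _ \<mu>]) auto
qed

text \<open>The convexity gap is the integral of the density against \<phi>, the gap of x \<mapsto>
  1 / (x + t), which is positive for every t in the range. The constant 1 cancels because u + v =
  1.\<close>

lemma log_ratio_strictly_convex:
  assumes r: "r > 1"
  shows "strictly_convex_on {- (1 / r)<..} (\<lambda>x. Re (log_ratio r (complex_of_real x)))"
  unfolding strictly_convex_on_def
proof (intro conjI ballI impI allI)
  show "convex {- (1 / r)<..}"
    by (rule convex_real_interval)
  fix x y u v :: real
  assume x: "x \<in> {- (1 / r)<..}" and y: "y \<in> {- (1 / r)<..}" and "x \<noteq> y"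
    and u: "u > 0" and v: "v > 0" and uv: "u + v = 1"
  let ?\<omega> = "log_ratio_density r"
  define I where "I x = (LINT t:{1 / r..}|lborel. ?\<omega> t / (x + t))" for x
  define m where "m = u * x + v * y"
  have Re: "Re (log_ratio r (complex_of_real x)) = 1 + I x" if "x > - (1 / r)" for x
    unfolding log_ratio_integral_real(2)[OF r that] I_def by simp
  have "u * x + v * y > u * (- (1 / r)) + v * (- (1 / r))"
    using x y u v by (intro add_strict_mono mult_strict_left_mono) auto
  then have m: "m > - (1 / r)"
    unfolding distrib_right [symmetric] uv m_def by simp
  note int = log_ratio_integral_real(1)[OF r]
  define \<phi> where "\<phi> t = u / (x + t) + v / (y + t) - 1 / (m + t)" for t
  have \<phi>_pos: "\<phi> t > 0" if t: "t \<ge> 1 / r" for t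
  proof -
    have "x + t > 0" "y + t > 0"
      using x y t by auto
    then have "1 / (u * (x + t) + v * (y + t)) < u / (x + t) + v / (y + t)"
      using \<open>x \<noteq> y\<close> u v uv by (intro inverse_strictly_convex) auto
    moreover have "u * (x + t) + v * (y + t) = m + (u + v) * t"
      by (simp add: m_def algebra_simps)
    ultimately show ?thesis
      using uv by (simp add: \<phi>_def)
  qed
  have eq: "?\<omega> t * \<phi> t = u * (?\<omega> t / (x + t)) + v * (?\<omega> t / (y + t)) - ?\<omega> t / (m + t)" for t
    by (simp add: \<phi>_def algebra_simps)
  have ints: "set_integrable lborel {1 / r..} (\<lambda>t. u * (?\<omega> t / (x + t)))"
      "set_integrable lborel {1 / r..} (\<lambda>t. v * (?\<omega> t / (y + t)))"
      "set_integrable lborel {1 / r..} (\<lambda>t. ?\<omega> t / (m + t))"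
    by (intro set_integrable_mult_right int; use x y m in simp)+
  have "(LINT t:{1 / r..}|lborel. ?\<omega> t * \<phi> t) = u * I x + v * I y - I m"
    unfolding eq using ints by (simp add: set_integral_diff set_integral_add I_def del: times_divide_eq_right)
  moreover have "(LINT t:{1 / r..}|lborel. ?\<omega> t * \<phi> t) > 0"
  proof (rule log_ratio_density_integral_pos[OF r \<phi>_pos])
    show "set_integrable lborel {1 / r..} (\<lambda>t. ?\<omega> t * \<phi> t)"
      unfolding eq using ints by (intro set_integral_diff set_integral_add)
  qed
  ultimately have "I m < u * I x + v * I y"
    by linarith
  moreover have "u * (1 + I x) + v * (1 + I y) = 1 + (u * I x + v * I y)"
    using uv by (simp add: algebra_simps)
  moreover have "u *\<^sub>R x + v *\<^sub>R y = m" "x > - (1 / r)" "y > - (1 / r)"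
    using x y by (simp_all add: m_def)
  ultimately show "Re (log_ratio r (complex_of_real (u *\<^sub>R x + v *\<^sub>R y)))
      < u * Re (log_ratio r (complex_of_real x)) + v * Re (log_ratio r (complex_of_real y))"
    by (simp only: Re m)
qed

text \<open>The difference of the two values is the integral of the density against 1 / (x + t) - 1
  / (y + t), which is positive for x < y.\<close>

lemma log_ratio_strict_antimono:
  assumes r: "r > 1"
  shows "strict_antimono_on {- (1 / r)<..} (\<lambda>x. Re (log_ratio r (complex_of_real x)))"
proof (rule monotone_onI)
  fix x y :: real
  assume x: "x \<in> {- (1 / r)<..}" and y: "y \<in> {- (1 / r)<..}" and xy: "x < y"
  let ?\<omega> = "log_ratio_density r"
  define \<phi> where "\<phi> t = 1 / (x + t) - 1 / (y + t)" for t
  have \<phi>_pos: "\<phi> t > 0" if t: "t \<ge> 1 / r" for t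
    using x xy t unfolding \<phi>_def by (simp add: frac_less2)
  have eq: "?\<omega> t * \<phi> t = ?\<omega> t / (x + t) - ?\<omega> t / (y + t)" for t
    by (simp add: \<phi>_def algebra_simps)
  have ints: "set_integrable lborel {1 / r..} (\<lambda>t. ?\<omega> t / (x + t))"
      "set_integrable lborel {1 / r..} (\<lambda>t. ?\<omega> t / (y + t))"
    using x y by (auto intro!: log_ratio_integral_real(1)[OF r])
  have "(LINT t:{1 / r..}|lborel. ?\<omega> t * \<phi> t) > 0"
  proof (rule log_ratio_density_integral_pos[OF r \<phi>_pos])
    show "set_integrable lborel {1 / r..} (\<lambda>t. ?\<omega> t * \<phi> t)"
      unfolding eq using ints by (intro set_integral_diff)
  qed
  then show "Re (log_ratio r (complex_of_real x)) > Re (log_ratio r (complex_of_real y))"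
    using x y ints log_ratio_integral_real(2)[OF r, of x] log_ratio_integral_real(2)[OF r, of y]
    unfolding eq by (simp add: set_integral_diff)
qed

theorem theorem4:
  fixes r :: real
  assumes "r > 1"
  shows
    "(\<forall>x>-1/r. log_ratio r (complex_of_real x) \<in> \<real>) \<and>

     (stieltjes_function (\<lambda>x. Re (log_ratio r (complex_of_real x))) \<and>
      (\<forall>z. z \<notin> complex_of_real ` {..-1/r} \<longrightarrow>
        set_integrable lborel {1/r..}
          (\<lambda>t. complex_of_real (log_ratio_density r t) / (z + complex_of_real t)) \<and>
        log_ratio r z = 1 + (LINT t:{1/r..}|lborel.
          complex_of_real (log_ratio_density r t) / (z + complex_of_real t)))) \<and>

     (strictly_convex_on {-1/r<..} (\<lambda>x. Re (log_ratio r (complex_of_real x))) \<and>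
      strict_antimono_on {-1/r<..} (\<lambda>x. Re (log_ratio r (complex_of_real x))) \<and>
      filterlim (\<lambda>x. Re (log_ratio r (complex_of_real x))) at_top (at_right (-1/r)) \<and>
      ((\<lambda>x. Re (log_ratio r (complex_of_real x))) \<longlongrightarrow> 1) at_top) \<and>

     (set_integrable lborel {1/r..} (\<lambda>t. log_ratio_density r t / t) \<and>
      (LINT t:{1/r..}|lborel. log_ratio_density r t / t) = r - 1)"
proof -
  have minus: "-1 / r = - (1 / r)"
    by simp
  \<comment> \<open>The point x = 0 is admissible in the real representation, and
    \<open>log_ratio r 0\<close> is r by definition; this gives the last integral.\<close>
  have "- (1 / r) < 0"
    using assms by simp
  note zero = log_ratio_integral_real[OF assms this]
  have "complex_of_real r = of_real (1 + (LINT t:{1 / r..}|lborel. log_ratio_density r t / t))"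
    using zero(2) by (simp add: log_ratio_def)
  then have "r = 1 + (LINT t:{1 / r..}|lborel. log_ratio_density r t / t)"
    by (simp only: of_real_eq_iff)
  then have integral: "(LINT t:{1 / r..}|lborel. log_ratio_density r t / t) = r - 1"
    by linarith
  have integrable: "set_integrable lborel {1 / r..} (\<lambda>t. log_ratio_density r t / t)"
    using zero(1) by simp
  have reals: "log_ratio r (complex_of_real x) \<in> \<real>" if "x > - (1 / r)" for x
    unfolding log_ratio_integral_real(2)[OF assms that] by (rule Reals_of_real)
  show ?thesis
    unfolding minus
    using reals stieltjes_log_ratio[OF assms] log_ratio_integral[OF assms] log_ratio_strictly_convex[OF assms]
      log_ratio_strict_antimono[OF assms] log_ratio_at_left_end[OF assms] log_ratio_tendsto_1[OF assms]
      integrable integral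
    by (intro conjI allI impI)
qed

end
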